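(* Let $p\in(1,\infty)$ and $b=(b_n)_{n=0}^\infty\in\ell^1$. Then $b\in\mathscr{M}(d_p)$ if and only if $$\sum_{n=0}^\infty 2^n\sup_{2^n\le k<2^{n+1}}\Big|\sum_{\frac{k}{2}<j\le k}b_ja_{k-j}\Big|^p<\infty\quad\text{for every } a=(a_n)_{n=0}^\infty\in d_p,$$ where $j,k$ range over integers.
   Context: Let $\mathbb{N}_0=\{0,1,2,\dots\}$ and $\ell^1=\ell^1(\mathbb{N}_0)$ (complex sequences). For $p\in[1,\infty)$, $d_p$ is the Banach space of all complex sequences $a=(a_n)_{n=0}^\infty$ with $\|a\|_{d_p}:=\big(\sum_{n=0}^\infty\sup_{k\ge n}|a_k|^p\big)^{1/p}<\infty$. The convolution of $a,b\in\mathbb{C}^{\mathbb{N}_0}$ is $(a*b)_n:=\sum_{j=0}^n a_jb_{n-j}$, $n\in\mathbb{N}_0$. The multiplier algebra of $d_p$ is $\mathscr{M}(d_p):=\{b\in\mathbb{C}^{\mathbb{N}_0}: a*b\in d_p \text{ for all } a\in d_p\}$. *)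

theory Defs
  imports "HOL-Analysis.Analysis"
begin

text \<open>
  Suprema and sums of nonnegative terms are taken in \<^typ>\<open>ennreal\<close>, where they exist
  unconditionally, so that finiteness of the norm is a genuine condition: over \<^typ>\<open>real\<close>, the
  supremum of an unbounded set and the sum of a divergent series are unspecified.
\<close>

definition dp_norm :: "real \<Rightarrow> (nat \<Rightarrow> complex) \<Rightarrow> ennreal" where
  "dp_norm p a =
     (let S = (\<Sum>n. SUP k\<in>{n..}. ennreal (norm (a k) powr p))
      in if S = \<infinity> then \<infinity> else ennreal (enn2real S powr (1 / p)))"

definition dp_space :: "real \<Rightarrow> (nat \<Rightarrow> complex) set" where
  "dp_space p = {a. dp_norm p a < \<infinity>}"

definition l1_space :: "(nat \<Rightarrow> complex) set" where
  "l1_space = {a. summable (\<lambda>n. norm (a n))}"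

definition convolution :: "(nat \<Rightarrow> complex) \<Rightarrow> (nat \<Rightarrow> complex) \<Rightarrow> nat \<Rightarrow> complex" where
  "convolution a b n = (\<Sum>j=0..n. a j * b (n - j))"

definition multiplier_algebra :: "(nat \<Rightarrow> complex) set \<Rightarrow> (nat \<Rightarrow> complex) set" where
  "multiplier_algebra X = {b. \<forall>a\<in>X. convolution a b \<in> X}"

end

theory Submission
  imports Defs
begin

text \<open>
  Split the convolution at the middle index. In the low half, \<open>j \<le> k/2\<close>, the sequence \<open>a\<close> is only
  evaluated at indices \<open>k - j \<ge> k/2\<close>, so this half is bounded by the \<open>\<ell>\<^sup>1\<close>-norm of \<open>b\<close> times the
  least decreasing majorant of \<open>|a|\<close> at \<open>k/2\<close>. The \<open>d\<^sub>p\<close>-norm is the \<open>\<ell>\<^sup>p\<close>-norm of that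
  majorant, and replacing \<open>k\<close> by \<open>k/2\<close> merely repeats each of its values twice; hence the low half
  lies in \<open>d\<^sub>p\<close> for every \<open>a\<close> in \<open>d\<^sub>p\<close> (\<open>low_half_in_dp_space\<close>). As \<open>d\<^sub>p\<close> is a vector space,
  \<open>a * b\<close> belongs to it exactly when the high half, \<open>k/2 < j \<le> k\<close>, does.

  It remains to express membership of the high half in terms of dyadic blocks
  (\<open>dp_space_iff_dyadic\<close>). One direction is Cauchy condensation for the decreasing majorant
  (\<open>dyadic_sum_le_majorant_sum\<close>). For the other, the majorant at \<open>n\<close> is at most the sum of the block
  suprema over all blocks that reach beyond \<open>n\<close>, and when summing over \<open>n\<close> the block
  \<open>{2\<^sup>m..<2\<^sup>m\<^sup>+\<^sup>1}\<close> is counted only \<open>2\<^sup>m\<^sup>+\<^sup>1\<close> times (\<open>majorant_sum_le_dyadic_sum\<close>).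
\<close>

section \<open>Decreasing majorants and dyadic blocks\<close>

definition decreasing_majorant :: "(nat \<Rightarrow> ennreal) \<Rightarrow> nat \<Rightarrow> ennreal" where
  "decreasing_majorant u n = (SUP k\<in>{n..}. u k)"

definition dyadic_sup :: "(nat \<Rightarrow> ennreal) \<Rightarrow> nat \<Rightarrow> ennreal" where
  "dyadic_sup u n = (SUP k\<in>{2 ^ n..<2 ^ (n + 1)}. u k)"

lemma le_decreasing_majorant: "n \<le> k \<Longrightarrow> u k \<le> decreasing_majorant u n"
  unfolding decreasing_majorant_def by (rule SUP_upper) simp

lemma decreasing_majorant_antimono:
  "m \<le> n \<Longrightarrow> decreasing_majorant u n \<le> decreasing_majorant u m"
  unfolding decreasing_majorant_def by (rule SUP_subset_mono) auto

lemma dyadic_sup_le_decreasing_majorant: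
  "dyadic_sup u n \<le> decreasing_majorant u (2 ^ n)"
  unfolding dyadic_sup_def decreasing_majorant_def by (rule SUP_subset_mono) auto

text \<open>
  Cauchy condensation: as \<open>v\<close> decreases, \<open>2\<^sup>n\<^sup>+\<^sup>1 v(2\<^sup>n\<^sup>+\<^sup>1)\<close> is at most twice the sum of \<open>v\<close> over the
  \<open>2\<^sup>n\<close> indices of the preceding block.
\<close>
lemma condensation_partial_sum:
  fixes v :: "nat \<Rightarrow> ennreal"
  assumes anti: "\<And>m n. m \<le> n \<Longrightarrow> v n \<le> v m"
  shows "(\<Sum>n\<le>N. 2 ^ n * v (2 ^ n)) \<le> 2 * (\<Sum>j<2 ^ N. v j)"
proof (induction N)
  case 0
  have "v 1 \<le> v 0" by (rule anti) simp
  also have "v 0 \<le> 2 * v 0" by (simp add: mult_2)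
  finally show ?case by simp
next
  case (Suc N)
  have "(2::ennreal) ^ N * v (2 ^ Suc N) = (\<Sum>j\<in>{2 ^ N..<2 ^ Suc N :: nat}. v (2 ^ Suc N))"
    by simp
  also have "\<dots> \<le> (\<Sum>j\<in>{2 ^ N..<2 ^ Suc N}. v j)"
    by (rule sum_mono) (simp add: anti)
  finally have block: "(2::ennreal) ^ N * v (2 ^ Suc N) \<le> (\<Sum>j\<in>{2 ^ N..<2 ^ Suc N}. v j)" .
  have split: "{..<2 ^ Suc N} = {..<2 ^ N} \<union> {2 ^ N..<2 ^ Suc N :: nat}"
    by (rule ivl_disj_un_one(2)[symmetric]) simp
  have "(\<Sum>n\<le>Suc N. 2 ^ n * v (2 ^ n)) =
      (\<Sum>n\<le>N. 2 ^ n * v (2 ^ n)) + 2 * (2 ^ N * v (2 ^ Suc N))"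
    by (simp add: mult.assoc)
  also have "\<dots> \<le> 2 * (\<Sum>j<2 ^ N. v j) + 2 * (\<Sum>j\<in>{2 ^ N..<2 ^ Suc N}. v j)"
    by (intro add_mono Suc.IH mult_left_mono block) simp
  also have "\<dots> = 2 * (\<Sum>j<2 ^ Suc N. v j)"
    unfolding split by (subst sum.union_disjoint) (auto simp: distrib_left)
  finally show ?case .
qed

lemma dyadic_sum_le_majorant_sum:
  "(\<Sum>n. 2 ^ n * dyadic_sup u n) \<le> 2 * (\<Sum>n. decreasing_majorant u n)"
proof (rule suminf_le_const)
  fix N
  have "(\<Sum>n<N. 2 ^ n * dyadic_sup u n) \<le> (\<Sum>n\<le>N. 2 ^ n * decreasing_majorant u (2 ^ n))"
    by (intro sum_mono2 order_trans[OF sum_mono sum_mono2] mult_left_mono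
          dyadic_sup_le_decreasing_majorant) auto
  also have "\<dots> \<le> 2 * (\<Sum>j<2 ^ N. decreasing_majorant u j)"
    by (rule condensation_partial_sum) (rule decreasing_majorant_antimono)
  also have "\<dots> \<le> 2 * (\<Sum>j. decreasing_majorant u j)"
    by (intro mult_left_mono sum_le_suminf) auto
  finally show "(\<Sum>n<N. 2 ^ n * dyadic_sup u n) \<le> 2 * (\<Sum>n. decreasing_majorant u n)" .
qed simp

text \<open>
  Block \<open>m\<close> contributes to the majorant at \<open>n\<close> only if it contains an index \<open>\<ge> n\<close>, that is, if
  \<open>n < 2\<^sup>m\<^sup>+\<^sup>1\<close>. The index \<open>0\<close> lies in no block and has to be accounted for separately.
\<close>
lemma decreasing_majorant_le_blocks:
  "decreasing_majorant u n \<le>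
    (if n = 0 then u 0 else 0) + (\<Sum>m. if n < 2 ^ (m + 1) then dyadic_sup u m else 0)"
  unfolding decreasing_majorant_def
proof (rule SUP_least)
  fix k assume "k \<in> {n..}"
  hence nk: "n \<le> k" by simp
  show "u k \<le> (if n = 0 then u 0 else 0) + (\<Sum>m. if n < 2 ^ (m + 1) then dyadic_sup u m else 0)"
  proof (cases "k = 0")
    case True
    then show ?thesis using nk by (simp add: add_increasing2)
  next
    case False
    then obtain m where m: "2 ^ m \<le> k" "k < 2 ^ (m + 1)"
      using ex_power_ivl1[of 2 k] by auto
    have "u k \<le> dyadic_sup u m"
      unfolding dyadic_sup_def by (rule SUP_upper) (use m in auto)
    also have "\<dots> = (if n < 2 ^ (m + 1) then dyadic_sup u m else 0)"
      using nk m by simp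
    also have "\<dots> = (\<Sum>m\<in>{m}. if n < 2 ^ (m + 1) then dyadic_sup u m else 0)"
      by simp
    also have "\<dots> \<le> (\<Sum>m. if n < 2 ^ (m + 1) then dyadic_sup u m else 0)"
      by (rule sum_le_suminf) auto
    finally show ?thesis by (simp add: add_increasing)
  qed
qed

lemma majorant_sum_le_dyadic_sum:
  "(\<Sum>n. decreasing_majorant u n) \<le> u 0 + 2 * (\<Sum>n. 2 ^ n * dyadic_sup u n)"
proof -
  let ?f = "\<lambda>(n::nat) m. if n < 2 ^ (m + 1) then dyadic_sup u m else 0"
  have first: "(\<Sum>n. if n = 0 then u 0 else 0) = u 0"
    using suminf_finite[of "{0}" "\<lambda>n. if n = 0 then u 0 else 0"] by simp
  have block: "(\<Sum>n. ?f n m) = 2 * (2 ^ m * dyadic_sup u m)" for m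
  proof -
    have "(\<Sum>n. ?f n m) = (\<Sum>n<2 ^ (m + 1). ?f n m)"
      by (rule suminf_finite) auto
    also have "\<dots> = (\<Sum>n<2 ^ (m + 1) :: nat. dyadic_sup u m)"
      by (rule sum.cong) auto
    finally show ?thesis by (simp add: mult.assoc)
  qed
  have "(\<Sum>n. decreasing_majorant u n) \<le> (\<Sum>n. (if n = 0 then u 0 else 0) + (\<Sum>m. ?f n m))"
    by (intro suminf_le decreasing_majorant_le_blocks) auto
  also have "\<dots> = (\<Sum>n. if n = 0 then u 0 else 0) + (\<Sum>n. \<Sum>m. ?f n m)"
    by (rule suminf_add[symmetric]) auto
  also have "(\<Sum>n. \<Sum>m. ?f n m) = (\<Sum>m. \<Sum>n. ?f n m)"
    using nn_integral_suminf[of "\<lambda>m n. ?f n m" "count_space UNIV"]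
    by (simp add: nn_integral_count_space_nat)
  also have "\<dots> = 2 * (\<Sum>m. 2 ^ m * dyadic_sup u m)"
    unfolding block by simp
  finally show ?thesis unfolding first .
qed

text \<open>Halving the index repeats every value of a sequence twice.\<close>
lemma suminf_index_halved_le:
  fixes v :: "nat \<Rightarrow> ennreal"
  shows "(\<Sum>n. v (n div 2)) \<le> 2 * (\<Sum>n. v n)"
proof (rule suminf_le_const)
  fix N
  have pairs: "(\<Sum>n<2 * N. v (n div 2)) = 2 * (\<Sum>n<N. v n)"
    by (induction N) (simp_all add: distrib_left mult_2 add.assoc)
  have "(\<Sum>n<N. v (n div 2)) \<le> (\<Sum>n<2 * N. v (n div 2))"
    by (rule sum_mono2) auto
  also have "\<dots> \<le> 2 * (\<Sum>n. v n)"
    unfolding pairs by (intro mult_left_mono sum_le_suminf) auto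
  finally show "(\<Sum>n<N. v (n div 2)) \<le> 2 * (\<Sum>n. v n)" .
qed simp

section \<open>The space of sequences with \<open>p\<close>-summable decreasing majorant\<close>

lemma dp_space_iff_majorant:
  "a \<in> dp_space p \<longleftrightarrow>
    (\<Sum>n. decreasing_majorant (\<lambda>k. ennreal (norm (a k) powr p)) n) < \<infinity>"
  by (auto simp: dp_space_def dp_norm_def decreasing_majorant_def Let_def top.not_eq_extremum)

lemma dp_space_iff_dyadic:
  "a \<in> dp_space p \<longleftrightarrow> (\<Sum>n. 2 ^ n * dyadic_sup (\<lambda>k. ennreal (norm (a k) powr p)) n) < \<infinity>"
    (is "_ \<longleftrightarrow> ?D < \<infinity>")
proof
  let ?u = "\<lambda>k. ennreal (norm (a k) powr p)"
  assume "a \<in> dp_space p"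
  then have "2 * (\<Sum>n. decreasing_majorant ?u n) < \<infinity>"
    by (simp add: dp_space_iff_majorant ennreal_mult_less_top)
  then show "?D < \<infinity>"
    by (rule le_less_trans[OF dyadic_sum_le_majorant_sum])
next
  let ?u = "\<lambda>k. ennreal (norm (a k) powr p)"
  assume "?D < \<infinity>"
  then have "?u 0 + 2 * ?D < \<infinity>"
    by (simp add: ennreal_mult_less_top)
  then show "a \<in> dp_space p"
    unfolding dp_space_iff_majorant by (rule le_less_trans[OF majorant_sum_le_dyadic_sum])
qed

text \<open>
  The maximum of two numbers replaces convexity in this quasi-triangle inequality, so that it holds
  for all exponents \<open>p \<ge> 0\<close>.
\<close>
lemma norm_add_powr_le:
  fixes x y :: "'a :: real_normed_vector"
  assumes "0 \<le> p"
  shows "norm (x + y) powr p \<le> 2 powr p * (norm x powr p + norm y powr p)"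
proof -
  have "norm (x + y) \<le> 2 * max (norm x) (norm y)"
    using norm_triangle_ineq[of x y] by linarith
  then have "norm (x + y) powr p \<le> (2 * max (norm x) (norm y)) powr p"
    using assms by (intro powr_mono2) auto
  also have "\<dots> = 2 powr p * max (norm x) (norm y) powr p"
    by (intro powr_mult)
  also have "\<dots> \<le> 2 powr p * (norm x powr p + norm y powr p)"
    by (intro mult_left_mono) (auto simp: max_def)
  finally show ?thesis .
qed

lemma dp_space_add:
  assumes "0 \<le> p" and x: "x \<in> dp_space p" and y: "y \<in> dp_space p"
  shows "(\<lambda>k. x k + y k) \<in> dp_space p"
proof -
  let ?u = "\<lambda>z k. ennreal (norm (z k :: complex) powr p)"
  let ?C = "ennreal (2 powr p)"
  have "decreasing_majorant (?u (\<lambda>k. x k + y k)) n \<le>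
      ?C * (decreasing_majorant (?u x) n + decreasing_majorant (?u y) n)" for n
    unfolding decreasing_majorant_def[of "?u (\<lambda>k. x k + y k)"]
  proof (rule SUP_least)
    fix k assume "k \<in> {n..}"
    have "?u (\<lambda>k. x k + y k) k \<le> ennreal (2 powr p * (norm (x k) powr p + norm (y k) powr p))"
      using assms(1) by (intro ennreal_leI norm_add_powr_le)
    also have "\<dots> = ?C * (?u x k + ?u y k)"
      by (simp add: ennreal_mult)
    also have "\<dots> \<le> ?C * (decreasing_majorant (?u x) n + decreasing_majorant (?u y) n)"
      using \<open>k \<in> {n..}\<close>
      by (intro mult_left_mono add_mono le_decreasing_majorant[of n k "?u x"]
            le_decreasing_majorant[of n k "?u y"]) auto
    finally show "?u (\<lambda>k. x k + y k) k \<le>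
        ?C * (decreasing_majorant (?u x) n + decreasing_majorant (?u y) n)" .
  qed
  then have "(\<Sum>n. decreasing_majorant (?u (\<lambda>k. x k + y k)) n) \<le>
      (\<Sum>n. ?C * (decreasing_majorant (?u x) n + decreasing_majorant (?u y) n))"
    by (intro suminf_le) auto
  also have "\<dots> = ?C * ((\<Sum>n. decreasing_majorant (?u x) n) + (\<Sum>n. decreasing_majorant (?u y) n))"
    by (simp add: suminf_add)
  also have "\<dots> < \<infinity>"
    using x y by (simp add: dp_space_iff_majorant ennreal_mult_less_top)
  finally show ?thesis unfolding dp_space_iff_majorant .
qed

lemma dp_space_uminus: "x \<in> dp_space p \<Longrightarrow> (\<lambda>k. - x k) \<in> dp_space p"
  by (simp add: dp_space_iff_majorant)

section \<open>The two halves of the convolution\<close>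

lemma convolution_split_at_half:
  "convolution a b k =
    (\<Sum>j\<le>k div 2. b j * a (k - j)) + (\<Sum>j | real k / 2 < real j \<and> j \<le> k. b j * a (k - j))"
proof -
  have "convolution a b k = (\<Sum>j=0..k. b j * a (k - j))"
    unfolding convolution_def
    by (subst sum.atLeastAtMost_rev) (auto intro!: sum.cong simp: mult.commute)
  also have "{0..k} = {..k div 2} \<union> {j. real k / 2 < real j \<and> j \<le> k}"
    by auto
  also have "(\<Sum>j\<in>\<dots>. b j * a (k - j)) =
      (\<Sum>j\<le>k div 2. b j * a (k - j)) + (\<Sum>j | real k / 2 < real j \<and> j \<le> k. b j * a (k - j))"
    by (rule sum.union_disjoint) auto
  finally show ?thesis .
qed

text \<open>
  Only values \<open>a i\<close> with \<open>i \<ge> k/2\<close> enter, so Hoelder's inequality bounds the sum by the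
  \<open>\<ell>\<^sup>1\<close>-norm of \<open>b\<close> times the largest of them.
\<close>
lemma norm_low_half_le:
  assumes "b \<in> l1_space"
  obtains i where "k div 2 \<le> i"
    and "norm (\<Sum>j\<le>k div 2. b j * a (k - j)) \<le> (\<Sum>n. norm (b n)) * norm (a i)"
proof -
  let ?S = "{..k div 2}"
  define M where "M = Max ((\<lambda>j. norm (a (k - j))) ` ?S)"
  have "M \<in> (\<lambda>j. norm (a (k - j))) ` ?S"
    unfolding M_def by (rule Max_in) auto
  then obtain l where l: "l \<le> k div 2" "M = norm (a (k - l))"
    by auto
  have "norm (\<Sum>j\<in>?S. b j * a (k - j)) \<le> (\<Sum>j\<in>?S. norm (b j) * M)"
    unfolding M_def
    by (intro order_trans[OF norm_sum] sum_mono) (auto simp: norm_mult intro!: mult_left_mono)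
  also have "\<dots> = (\<Sum>j\<in>?S. norm (b j)) * M"
    by (simp add: sum_distrib_right)
  also have "\<dots> \<le> (\<Sum>n. norm (b n)) * M"
    using assms l(2) by (intro mult_right_mono sum_le_suminf) (auto simp: l1_space_def)
  finally show thesis
    using that[of "k - l"] l by simp
qed

lemma low_half_in_dp_space:
  assumes "0 \<le> p" and b: "b \<in> l1_space" and a: "a \<in> dp_space p"
  shows "(\<lambda>k. \<Sum>j\<le>k div 2. b j * a (k - j)) \<in> dp_space p"
proof -
  define c where "c k = (\<Sum>j\<le>k div 2. b j * a (k - j))" for k
  define B where "B = (\<Sum>n. norm (b n))"
  define v where "v = decreasing_majorant (\<lambda>k. ennreal (norm (a k) powr p))"
  have B: "0 \<le> B"
    unfolding B_def using b by (intro suminf_nonneg) (auto simp: l1_space_def)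
  have pointwise: "ennreal (norm (c k) powr p) \<le> ennreal (B powr p) * v (k div 2)" for k
  proof -
    obtain i where i: "k div 2 \<le> i" "norm (c k) \<le> B * norm (a i)"
      using norm_low_half_le[OF b] unfolding c_def B_def by blast
    have "norm (c k) powr p \<le> (B * norm (a i)) powr p"
      using i(2) assms(1) by (intro powr_mono2) auto
    also have "\<dots> = B powr p * norm (a i) powr p"
      by (intro powr_mult)
    finally have "ennreal (norm (c k) powr p) \<le> ennreal (B powr p) * ennreal (norm (a i) powr p)"
      by (simp add: ennreal_mult[symmetric] ennreal_leI)
    also have "\<dots> \<le> ennreal (B powr p) * v (k div 2)"
      unfolding v_def by (intro mult_left_mono) (auto intro: le_decreasing_majorant[OF i(1)])
    finally show ?thesis .
  qed
  have "decreasing_majorant (\<lambda>k. ennreal (norm (c k) powr p)) n \<le>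
      ennreal (B powr p) * v (n div 2)" for n
    unfolding decreasing_majorant_def
  proof (rule SUP_least)
    fix k assume "k \<in> {n..}"
    then have "v (k div 2) \<le> v (n div 2)"
      unfolding v_def by (intro decreasing_majorant_antimono div_le_mono) simp
    then show "ennreal (norm (c k) powr p) \<le> ennreal (B powr p) * v (n div 2)"
      by (intro order_trans[OF pointwise] mult_left_mono) auto
  qed
  then have "(\<Sum>n. decreasing_majorant (\<lambda>k. ennreal (norm (c k) powr p)) n) \<le>
      (\<Sum>n. ennreal (B powr p) * v (n div 2))"
    by (intro suminf_le) auto
  also have "\<dots> \<le> ennreal (B powr p) * (2 * (\<Sum>n. v n))"
    by (simp add: mult_left_mono suminf_index_halved_le)
  also have "\<dots> < \<infinity>"
    using a by (simp add: dp_space_iff_majorant v_def ennreal_mult_less_top)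
  finally show ?thesis
    unfolding dp_space_iff_majorant c_def .
qed

theorem theorem5p1:
  fixes p :: real and b :: "nat \<Rightarrow> complex"
  assumes "1 < p" and "b \<in> l1_space"
  shows "b \<in> multiplier_algebra (dp_space p) \<longleftrightarrow>
    (\<forall>a\<in>dp_space p.
      (\<Sum>n. 2 ^ n * (SUP k\<in>{2 ^ n..<2 ^ (n + 1)}.
         ennreal (norm (\<Sum>j | real k / 2 < real j \<and> j \<le> k. b j * a (k - j)) powr p))) < \<infinity>)"
proof -
  define low where "low a k = (\<Sum>j\<le>k div 2. b j * a (k - j))" for a :: "nat \<Rightarrow> complex" and k
  define high where "high a k = (\<Sum>j | real k / 2 < real j \<and> j \<le> k. b j * a (k - j))"
    for a :: "nat \<Rightarrow> complex" and k :: nat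
  have split: "convolution a b k = low a k + high a k" for a k
    unfolding low_def high_def by (rule convolution_split_at_half)
  have "convolution a b \<in> dp_space p \<longleftrightarrow> high a \<in> dp_space p" if a: "a \<in> dp_space p" for a
  proof
    have low: "low a \<in> dp_space p"
      unfolding low_def using assms a by (intro low_half_in_dp_space) auto
    show "high a \<in> dp_space p" if "convolution a b \<in> dp_space p"
      using dp_space_add[OF _ that dp_space_uminus[OF low]] assms by (simp add: split)
    show "convolution a b \<in> dp_space p" if "high a \<in> dp_space p"
      using dp_space_add[OF _ low that] assms by (simp add: split[symmetric])
  qed
  then have "b \<in> multiplier_algebra (dp_space p) \<longleftrightarrow> (\<forall>a\<in>dp_space p. high a \<in> dp_space p)"
    by (auto simp: multiplier_algebra_def)
  then show ?thesis
    unfolding dp_space_iff_dyadic[of "high _"] dyadic_sup_def high_def .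
qed

end
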